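(* Let $G=(V,E)$ be a connected simple graph with $n\geq 2$ vertices $v_1,\dots,v_n$. Then for every vertex $v_i\in V$, $$\mathcal{RE}_G(v_i)\geq\frac{\left(\frac{1}{d_i}\sum\limits_{j:\, v_j\sim v_i}\frac{1}{d_j}\right)^{\frac{3}{2}}}{\left(\sum\limits_{j=1}^n\frac{1}{d_id_j}\left(\sum\limits_{k:\, v_k\sim v_i,\ v_k\sim v_j}\frac{1}{d_k}\right)^2\right)^{\frac{1}{2}}}.$$
   Context: All graphs are finite and simple. For a graph $G$ with vertices $v_1,\dots,v_n$, let $d_i$ be the degree of $v_i$; $v_j\sim v_i$ means that $v_j$ and $v_i$ are adjacent. The innermost sum in the denominator runs over all common neighbours $v_k$ of $v_i$ and $v_j$ (for $j=i$, over all neighbours of $v_i$); an empty sum is $0$. The Randić matrix $R(G)=(R_{ij})$ is the real symmetric $n\times n$ matrix with $R_{ij}=\frac{1}{\sqrt{d_id_j}}$ if $v_i\sim v_j$ and $R_{ij}=0$ otherwise. Put $|R(G)|=(R(G)R(G)^* )^{1/2}$ (positive semidefinite square root). The Randić energy of the vertex $v_i$ is $\mathcal{RE}_G(v_i)=|R(G)|_{ii}$, the $i$-th diagonal entry of $|R(G)|$. *)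

theory Defs
  imports "HOL-Analysis.Analysis" "Graph_Theory.Graph_Theory"
begin

text \<open>
  A finite simple graph is a \<^locale>\<open>pair_graph\<close>: its arc set is a symmetric irreflexive relation
  on a finite vertex set, each edge being represented by both of its orientations, so that
  \<^const>\<open>out_degree\<close> counts the neighbours of a vertex. The \<open>n\<close> vertices are listed by a bijection
  \<open>v\<close> from a finite index type \<open>'n\<close>, which also indexes the rows and columns of the matrix.
\<close>

definition degree_at :: "'a pair_pre_digraph \<Rightarrow> ('n::finite \<Rightarrow> 'a) \<Rightarrow> 'n \<Rightarrow> real" where
  "degree_at G v i = real (out_degree G (v i))"

definition adjacent_at :: "'a pair_pre_digraph \<Rightarrow> ('n::finite \<Rightarrow> 'a) \<Rightarrow> 'n \<Rightarrow> 'n \<Rightarrow> bool" where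
  "adjacent_at G v i j \<longleftrightarrow> v i \<rightarrow>\<^bsub>G\<^esub> v j"

definition randic_matrix :: "'a pair_pre_digraph \<Rightarrow> ('n::finite \<Rightarrow> 'a) \<Rightarrow> real^'n^'n" where
  "randic_matrix G v =
     (\<chi> i j. if adjacent_at G v i j then 1 / sqrt (degree_at G v i * degree_at G v j) else 0)"

definition pos_semidef :: "real^'n^'n \<Rightarrow> bool" where
  "pos_semidef A \<longleftrightarrow> transpose A = A \<and> (\<forall>x. 0 \<le> x \<bullet> (A *v x))"

text \<open>
  Meaningful for positive semidefinite \<open>A\<close>, where exactly one such \<open>B\<close> exists.
\<close>

definition psd_sqrt :: "real^'n^'n \<Rightarrow> real^'n^'n" where
  "psd_sqrt A = (THE B. pos_semidef B \<and> B ** B = A)"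

text \<open>For a real matrix the adjoint \<open>A\<^sup>*\<close> is the transpose.\<close>

definition mat_abs :: "real^'n^'n \<Rightarrow> real^'n^'n" where
  "mat_abs A = psd_sqrt (A ** transpose A)"

definition randic_vertex_energy :: "'a pair_pre_digraph \<Rightarrow> ('n::finite \<Rightarrow> 'a) \<Rightarrow> 'n \<Rightarrow> real" where
  "randic_vertex_energy G v i = mat_abs (randic_matrix G v) $ i $ i"

end

theory Submission
  imports Defs
begin

text \<open>
  The bound is a relation between the moments \<open>m k = e \<bullet> B\<^sup>k e\<close> of the positive semidefinite
  matrix \<open>B = |R|\<close> at the standard basis vector \<open>e\<close> of the vertex. The vertex energy is \<open>m 1\<close>.
  Since \<open>B\<^sup>2 = R R\<^sup>T\<close>, the even moments are explicit: \<open>m 2\<close> is a diagonal entry of \<open>R R\<^sup>T\<close>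
  and \<open>m 4\<close> is the sum of the squares in the corresponding row. Computing these entries gives the
  numerator and the denominator of the bound, so the claim is \<open>m 2 ^ 3 \<le> (m 1)\<^sup>2 * m 4\<close>.

  This follows from two applications of the Cauchy--Schwarz inequality. For the semidefinite form
  \<open>x \<bullet> B y\<close> and the vectors \<open>e\<close>, \<open>B e\<close> it reads \<open>(m 2)\<^sup>2 \<le> m 1 * m 3\<close>; for the inner product and
  the vectors \<open>B e\<close>, \<open>B\<^sup>2 e\<close> it reads \<open>(m 3)\<^sup>2 \<le> m 2 * m 4\<close>. Eliminating \<open>m 3\<close> and cancelling \<open>m 2\<close>
  gives the claim (\<open>pos_semidef_moment_inequality\<close>).

  For \<open>|R|\<close> to have these properties, a positive semidefinite matrix must have exactly one
  positive semidefinite square root. Both existence and uniqueness come from an orthonormal basis of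
  eigenvectors (\<open>self_adjoint_orthonormal_eigenbasis\<close>): take square roots of the eigenvalues, and
  observe that any square root of \<open>B\<^sup>2\<close> has to act like \<open>B\<close> on the eigenvectors of \<open>B\<close>.
\<close>

section \<open>Self-adjoint maps\<close>

text \<open>
  As usual, \<open>t \<mapsto> (x + t y) \<bullet> g (x + t y)\<close> is a nonnegative polynomial of degree at most two.
  Semidefiniteness is required only on a subspace, because the spectral theorem applies the
  inequality on an invariant subspace.
\<close>

lemma semidefinite_Cauchy_Schwarz:
  fixes g :: "'a::real_inner \<Rightarrow> 'a"
  assumes g: "linear g" and adj: "\<And>x y. x \<bullet> g y = g x \<bullet> y"
    and S: "subspace S" and psd: "\<And>x. x \<in> S \<Longrightarrow> 0 \<le> x \<bullet> g x"
    and x: "x \<in> S" and y: "y \<in> S"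
  shows "(x \<bullet> g y)\<^sup>2 \<le> (x \<bullet> g x) * (y \<bullet> g y)"
proof -
  define a b c where "a = x \<bullet> g x" and "b = x \<bullet> g y" and "c = y \<bullet> g y"
  have "y \<bullet> g x = b"
    using adj[of y x] by (simp add: b_def inner_commute)
  then have "(x + t *\<^sub>R y) \<bullet> g (x + t *\<^sub>R y) = a + 2 * b * t + c * t\<^sup>2" for t
    by (simp add: linear_add[OF g] linear_scale[OF g] inner_add_left inner_add_right
        a_def b_def c_def power2_eq_square algebra_simps)
  moreover have "x + t *\<^sub>R y \<in> S" for t
    using x y S by (simp add: subspace_add subspace_scale)
  ultimately have q: "0 \<le> a + 2 * b * t + c * t\<^sup>2" for t
    using psd by metis
  have "b\<^sup>2 \<le> a * c"
  proof (cases "c = 0")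
    case True
    have "b = 0"
    proof (rule ccontr)
      assume "b \<noteq> 0"
      \<comment> \<open>With \<open>c = 0\<close> the polynomial is affine with slope \<open>2 b\<close>; at this point it equals \<open>-1\<close>.\<close>
      then show False
        using q[of "- (a + 1) / (2 * b)"] True by simp
    qed
    then show ?thesis using True by simp
  next
    case False
    then have "c > 0" using psd[OF y] by (simp add: c_def)
    \<comment> \<open>The minimum of the polynomial is at \<open>- b / c\<close>.\<close>
    then show ?thesis
      using q[of "- b / c"] by (simp add: field_simps power2_eq_square)
  qed
  then show ?thesis by (simp add: a_def b_def c_def)
qed

text \<open>
  A maximiser \<open>u\<close> of the Rayleigh quotient on the unit sphere of \<open>S\<close>, with maximum \<open>c\<close>, is an
  eigenvector. Indeed \<open>g = c - f\<close> is semidefinite on \<open>S\<close> and \<open>u \<bullet> g u = 0\<close>, so the Cauchy--Schwarz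
  inequality for the form of \<open>g\<close>, applied to \<open>g u\<close> and \<open>u\<close>, forces \<open>g u = 0\<close>.
\<close>

lemma self_adjoint_unit_eigenvector:
  fixes f :: "'a::euclidean_space \<Rightarrow> 'a"
  assumes f: "linear f" and adj: "\<And>x y. x \<bullet> f y = f x \<bullet> y"
    and S: "subspace S" and inv: "f ` S \<subseteq> S" and nz: "S \<noteq> {0}"
  obtains u c where "u \<in> S" "norm u = 1" "f u = c *\<^sub>R u"
proof -
  obtain z where z: "z \<in> S" "z \<noteq> 0"
    using nz S subspace_0 by blast
  then have "(1 / norm z) *\<^sub>R z \<in> S \<inter> sphere 0 1"
    using S by (simp add: subspace_scale)
  then have ne: "S \<inter> sphere 0 1 \<noteq> {}" by blast
  have "compact (S \<inter> sphere 0 1)"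
    using closed_subspace[OF S] by (simp add: closed_Int_compact)
  moreover have "continuous_on (S \<inter> sphere 0 1) (\<lambda>x. x \<bullet> f x)"
    using f by (intro continuous_intros linear_continuous_on) (simp add: linear_conv_bounded_linear)
  ultimately obtain u where u: "u \<in> S" "norm u = 1"
    and max: "\<And>x. x \<in> S \<Longrightarrow> norm x = 1 \<Longrightarrow> x \<bullet> f x \<le> u \<bullet> f u"
    using continuous_attains_sup[OF _ ne, of "\<lambda>x. x \<bullet> f x"] by auto
  define c where "c = u \<bullet> f u"
  define g where "g x = c *\<^sub>R x - f x" for x
  have g: "linear g"
    unfolding g_def using f by (intro linear_compose_sub linear_compose_scale_right linear_ident)
  have g_adj: "x \<bullet> g y = g x \<bullet> y" for x y
    by (simp add: g_def inner_diff_left inner_diff_right adj)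
  have g_psd: "0 \<le> x \<bullet> g x" if "x \<in> S" for x
  proof (cases "x = 0")
    case False
    define y where "y = (1 / norm x) *\<^sub>R x"
    have "y \<in> S" "norm y = 1"
      using that False S by (simp_all add: y_def subspace_scale)
    then have "0 \<le> y \<bullet> g y"
      using max[of y] by (simp add: g_def inner_diff_right c_def dot_square_norm)
    moreover have "x \<bullet> g x = (norm x)\<^sup>2 * (y \<bullet> g y)"
      using False by (simp add: y_def linear_scale[OF g] power2_eq_square)
    ultimately show ?thesis by simp
  qed simp
  have "u \<bullet> g u = 0"
    using u by (simp add: g_def inner_diff_right c_def dot_square_norm)
  moreover have gu: "g u \<in> S"
    using u inv S by (auto simp: g_def intro!: subspace_diff subspace_scale)
  ultimately have "(g u \<bullet> g u)\<^sup>2 \<le> 0"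
    using semidefinite_Cauchy_Schwarz[OF g g_adj S g_psd gu u(1)] by simp
  then have "f u = c *\<^sub>R u"
    by (simp add: g_def)
  with u that show ?thesis by blast
qed

text \<open>
  The spectral theorem, by induction on the dimension: split off one eigenvector \<open>u\<close> and continue
  in its orthogonal complement, which is invariant because \<open>f\<close> is self-adjoint. The invariant
  subspace \<open>S\<close> makes this induction possible inside one fixed type.
\<close>

theorem self_adjoint_orthonormal_eigenbasis:
  fixes f :: "'a::euclidean_space \<Rightarrow> 'a"
  assumes f: "linear f" and adj: "\<And>x y. x \<bullet> f y = f x \<bullet> y"
    and "subspace S" and "f ` S \<subseteq> S"
  obtains E where "E \<subseteq> S" "pairwise orthogonal E" "\<And>e. e \<in> E \<Longrightarrow> norm e = 1"
    "\<And>e. e \<in> E \<Longrightarrow> \<exists>c. f e = c *\<^sub>R e" "span E = S"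
proof -
  have "\<exists>E. E \<subseteq> S \<and> pairwise orthogonal E \<and> (\<forall>e\<in>E. norm e = 1) \<and>
      (\<forall>e\<in>E. \<exists>c. f e = c *\<^sub>R e) \<and> span E = S"
    using assms(3,4)
  proof (induction "dim S" arbitrary: S rule: less_induct)
    case less
    note S = less.prems(1) and inv = less.prems(2)
    show ?case
    proof (cases "S = {0}")
      case True
      then show ?thesis by (intro exI[of _ "{}"]) simp
    next
      case False
      then obtain u c where u: "u \<in> S" "norm u = 1" "f u = c *\<^sub>R u"
        using self_adjoint_unit_eigenvector[OF f adj S inv] by blast
      define T where "T = S \<inter> {x. u \<bullet> x = 0}"
      have T: "subspace T"
        unfolding T_def by (intro subspace_inter S subspace_hyperplane)
      have "f ` T \<subseteq> T"
        using inv by (auto simp: T_def adj u(3))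
      moreover have "dim T < dim S"
      proof (rule dim_psubset)
        have "u \<notin> T" using u(2) by (auto simp: T_def)
        then have "T \<subset> S" using u(1) unfolding T_def by blast
        then show "span T \<subset> span S"
          using S T by (simp add: span_eq_iff[THEN iffD2])
      qed
      ultimately obtain E where E: "E \<subseteq> T" "pairwise orthogonal E" "\<forall>e\<in>E. norm e = 1"
          "\<forall>e\<in>E. \<exists>c. f e = c *\<^sub>R e" "span E = T"
        using less.hyps T by blast
      have "pairwise orthogonal (insert u E)"
        using E(1,2) by (auto simp: pairwise_insert orthogonal_def T_def inner_commute)
      moreover have "span (insert u E) = S"
      proof
        show "span (insert u E) \<subseteq> S"
          using u(1) E(1) S by (intro span_minimal) (auto simp: T_def)
        show "S \<subseteq> span (insert u E)"
        proof
          fix x assume "x \<in> S"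
          then have "x - (u \<bullet> x) *\<^sub>R u \<in> T"
            using S u by (auto simp: T_def inner_diff_right dot_square_norm
                intro!: subspace_diff subspace_scale)
          then show "x \<in> span (insert u E)"
            using E(5) by (auto simp: span_insert)
        qed
      qed
      ultimately show ?thesis
        using u E by (intro exI[of _ "insert u E"]) (auto simp: T_def)
    qed
  qed
  then show ?thesis using that by blast
qed

section \<open>The positive semidefinite square root\<close>

lemma symmetric_matrix_self_adjoint:
  fixes A :: "real^'n^'n"
  assumes "transpose A = A"
  shows "x \<bullet> (A *v y) = (A *v x) \<bullet> y"
  by (metis assms dot_lmul_matrix transpose_matrix_vector)

lemma symmetric_matrix_eigenbasis:
  fixes A :: "real^'n^'n"
  assumes "transpose A = A"
  obtains E c where "finite E" "pairwise orthogonal E" "\<And>e. e \<in> E \<Longrightarrow> norm e = 1"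
    "\<And>e. e \<in> E \<Longrightarrow> A *v e = c e *\<^sub>R e" "span E = UNIV"
proof -
  obtain E where E: "pairwise orthogonal E" "\<And>e. e \<in> E \<Longrightarrow> norm e = 1"
    "\<And>e. e \<in> E \<Longrightarrow> \<exists>c. A *v e = c *\<^sub>R e" "span E = UNIV"
    using self_adjoint_orthonormal_eigenbasis[of "(*v) A" UNIV]
      symmetric_matrix_self_adjoint[OF assms] by auto
  moreover obtain c where "\<And>e. e \<in> E \<Longrightarrow> A *v e = c e *\<^sub>R e"
    using E(3) by metis
  moreover have "finite E"
    using E(1) by (rule pairwise_orthogonal_imp_finite)
  ultimately show ?thesis using that by blast
qed

text \<open>
  The square root multiplies each vector \<open>e\<close> of an orthonormal eigenbasis by the square root of
  its eigenvalue.
\<close>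

lemma pos_semidef_sqrt_exists:
  fixes A :: "real^'n^'n"
  assumes "pos_semidef A"
  shows "\<exists>B. pos_semidef B \<and> B ** B = A"
proof -
  have sym: "transpose A = A" and psd: "\<And>x. 0 \<le> x \<bullet> (A *v x)"
    using assms by (auto simp: pos_semidef_def)
  obtain E c where E: "finite E" "pairwise orthogonal E" "\<And>e. e \<in> E \<Longrightarrow> norm e = 1"
    "\<And>e. e \<in> E \<Longrightarrow> A *v e = c e *\<^sub>R e" "span E = UNIV"
    using symmetric_matrix_eigenbasis[OF sym] by blast
  have c: "0 \<le> c e" if "e \<in> E" for e
    using psd[of e] E(3,4)[OF that] by (simp add: dot_square_norm)
  define g where "g x = (\<Sum>e\<in>E. (sqrt (c e) * (e \<bullet> x)) *\<^sub>R e)" for x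
  have g: "linear g"
    unfolding g_def
    by (intro linearI)
      (simp_all add: inner_add_right distrib_left scaleR_add_left sum.distrib scaleR_sum_right
        mult.left_commute)
  have g_adj: "x \<bullet> g y = g x \<bullet> y" for x y
    by (auto simp: g_def inner_sum_left inner_sum_right inner_commute intro!: sum.cong)
  have g_psd: "0 \<le> x \<bullet> g x" for x
    using c by (auto simp: g_def inner_sum_right inner_commute mult.assoc intro!: sum_nonneg)
  have g_E: "g e = sqrt (c e) *\<^sub>R e" if "e \<in> E" for e
  proof -
    have "g e = (\<Sum>e'\<in>E. if e' = e then sqrt (c e) *\<^sub>R e else 0)"
      unfolding g_def using E(2,3) that
      by (intro sum.cong) (auto simp: pairwise_def orthogonal_def dot_square_norm)
    then show ?thesis using E(1) that by simp
  qed
  define B where "B = matrix g"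
  have B: "B *v x = g x" for x
    using g by (simp add: B_def matrix_works)
  have "transpose B = B"
    unfolding B_def using g g_adj matrix_adjoint[OF g] adjoint_unique[of g g] by metis
  then have "pos_semidef B"
    using g_psd by (simp add: pos_semidef_def B)
  moreover have "B ** B = A"
  proof -
    have "(B ** B) *v x = A *v x" for x
    proof (rule linear_eq_on_span[of "(*v) (B ** B)" "(*v) A" E])
      fix e assume e: "e \<in> E"
      then have "B *v (B *v e) = A *v e"
        using c[OF e] by (simp add: B g_E linear_scale[OF g] E(4))
      then show "(B ** B) *v e = A *v e"
        by (simp add: matrix_vector_mul_assoc)
    qed (auto simp: E(5))
    then show ?thesis by (simp add: matrix_eq)
  qed
  ultimately show ?thesis by blast
qed

text \<open>
  Let \<open>e\<close> be an eigenvector of \<open>B\<close> with eigenvalue \<open>m \<ge> 0\<close>. Then \<open>C\<^sup>2 e = m\<^sup>2 e\<close>, that is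
  \<open>(C + m) (C - m) e = 0\<close>, and a semidefinite \<open>C\<close> cannot have the eigenvalue \<open>- m\<close> if \<open>m > 0\<close>.
  So \<open>C e = m e\<close>, and \<open>C\<close> agrees with \<open>B\<close> on an eigenbasis of \<open>B\<close>.
\<close>

lemma pos_semidef_sqrt_unique:
  fixes B C :: "real^'n^'n"
  assumes B: "pos_semidef B" and C: "pos_semidef C" and eq: "B ** B = C ** C"
  shows "B = C"
proof -
  have symB: "transpose B = B" and psdB: "\<And>x. 0 \<le> x \<bullet> (B *v x)"
    and symC: "transpose C = C" and psdC: "\<And>x. 0 \<le> x \<bullet> (C *v x)"
    using B C by (auto simp: pos_semidef_def)
  obtain E c where "finite E" "pairwise orthogonal E" and E: "\<And>e. e \<in> E \<Longrightarrow> norm e = 1"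
    "\<And>e. e \<in> E \<Longrightarrow> B *v e = c e *\<^sub>R e" "span E = UNIV"
    using symmetric_matrix_eigenbasis[OF symB] by blast
  have "B *v x = C *v x" for x
  proof (rule linear_eq_on_span[of "(*v) B" "(*v) C" E])
    fix e assume e: "e \<in> E"
    define m where "m = c e"
    have Be: "B *v e = m *\<^sub>R e" using E(2)[OF e] by (simp add: m_def)
    have m: "0 \<le> m"
      using psdB[of e] E(1)[OF e] by (simp add: Be dot_square_norm)
    have "C *v (C *v e) = B *v (B *v e)"
      by (simp add: matrix_vector_mul_assoc eq)
    then have CC: "C *v (C *v e) = (m * m) *\<^sub>R e"
      by (simp add: Be matrix_vector_mult_scaleR)
    have "C *v e = m *\<^sub>R e"
    proof (cases "m = 0")
      case True
      then have "(C *v e) \<bullet> (C *v e) = 0"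
        using symmetric_matrix_self_adjoint[OF symC, of e "C *v e"] CC by simp
      then show ?thesis using True by simp
    next
      case False
      define w where "w = C *v e - m *\<^sub>R e"
      have "C *v w = - m *\<^sub>R w"
        by (simp add: w_def matrix_vector_mult_diff_distrib matrix_vector_mult_scaleR CC
            scaleR_diff_right)
      then have "m * (w \<bullet> w) \<le> 0"
        using psdC[of w] by simp
      then have "w \<bullet> w \<le> 0"
        using m False by (simp add: mult_le_0_iff)
      then have "w = 0"
        by (metis inner_gt_zero_iff not_le)
      then show ?thesis by (simp add: w_def)
    qed
    then show "B *v e = C *v e" by (simp add: Be)
  qed (auto simp: E(3))
  then show ?thesis by (simp add: matrix_eq)
qed

lemma psd_sqrt_works:
  fixes A :: "real^'n^'n"
  assumes "pos_semidef A"
  shows "pos_semidef (psd_sqrt A)" and "psd_sqrt A ** psd_sqrt A = A"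
proof -
  have "\<exists>!B. pos_semidef B \<and> B ** B = A"
    using pos_semidef_sqrt_exists[OF assms] pos_semidef_sqrt_unique by metis
  from theI'[OF this] show "pos_semidef (psd_sqrt A)" "psd_sqrt A ** psd_sqrt A = A"
    by (simp_all add: psd_sqrt_def)
qed

lemma pos_semidef_mult_transpose: "pos_semidef (A ** transpose A)"
  for A :: "real^'n^'n"
proof -
  have "x \<bullet> ((A ** transpose A) *v x) = (transpose A *v x) \<bullet> (transpose A *v x)" for x
    by (metis dot_lmul_matrix matrix_vector_mul_assoc transpose_matrix_vector)
  then show ?thesis
    by (simp add: pos_semidef_def matrix_transpose_mul)
qed

section \<open>Moments of a positive semidefinite matrix\<close>

text \<open>
  In terms of the moments \<open>m k = x \<bullet> B\<^sup>k x\<close> this is \<open>m 2 ^ 3 \<le> (m 1)\<^sup>2 * m 4\<close>, obtained by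
  eliminating \<open>m 3\<close> between two Cauchy--Schwarz inequalities.
\<close>

lemma pos_semidef_moment_inequality:
  fixes B :: "real^'n^'n" and x :: "real^'n"
  assumes "pos_semidef B"
  shows "((B *v x) \<bullet> (B *v x)) ^ 3
    \<le> (x \<bullet> (B *v x))\<^sup>2 * ((B *v (B *v x)) \<bullet> (B *v (B *v x)))"
proof -
  have sym: "transpose B = B" and psd: "\<And>x. 0 \<le> x \<bullet> (B *v x)"
    using assms by (auto simp: pos_semidef_def)
  note adj = symmetric_matrix_self_adjoint[OF sym]
  define m1 m2 m3 m4 where "m1 = x \<bullet> (B *v x)" and "m2 = (B *v x) \<bullet> (B *v x)"
    and "m3 = (B *v x) \<bullet> (B *v (B *v x))" and "m4 = (B *v (B *v x)) \<bullet> (B *v (B *v x))"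
  have "m2 ^ 2 \<le> m1 * m3"
    using semidefinite_Cauchy_Schwarz[of "(*v) B" UNIV x "B *v x"] adj psd
    by (simp add: m1_def m2_def m3_def)
  then have "(m2 ^ 2) ^ 2 \<le> (m1 * m3) ^ 2"
    by (rule power_mono) simp
  also have "\<dots> = m1 ^ 2 * m3 ^ 2"
    by (rule power_mult_distrib)
  also have "\<dots> \<le> m1 ^ 2 * (m2 * m4)"
    unfolding m2_def m3_def m4_def by (intro mult_left_mono Cauchy_Schwarz_ineq) simp
  finally have le: "m2 * m2 ^ 3 \<le> m2 * (m1 ^ 2 * m4)"
    by (simp add: power_numeral_reduce algebra_simps)
  have "0 \<le> m2" "0 \<le> m4"
    by (simp_all add: m2_def m4_def)
  then have "m2 ^ 3 \<le> m1 ^ 2 * m4"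
    using le by (cases "m2 = 0") auto
  then show ?thesis
    by (simp add: m1_def m2_def m4_def)
qed

text \<open>
  The moment inequality for \<open>|A|\<close> at a standard basis vector, after taking square roots. If the
  row of \<open>M\<close> vanishes, the quotient is \<open>0\<close> by the convention for division by zero, and the bound
  says only that the diagonal of \<open>|A|\<close> is nonnegative.
\<close>

lemma mat_abs_diagonal_lower_bound:
  fixes A :: "real^'n^'n"
  defines "M \<equiv> A ** transpose A"
  shows "(M $ i $ i) powr (3 / 2) / (\<Sum>j\<in>UNIV. (M $ i $ j)\<^sup>2) powr (1 / 2) \<le> mat_abs A $ i $ i"
proof -
  define B where "B = mat_abs A"
  have "pos_semidef M" unfolding M_def by (rule pos_semidef_mult_transpose)
  then have B: "pos_semidef B" and BB: "B ** B = M"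
    using psd_sqrt_works[of M] by (simp_all add: B_def mat_abs_def M_def)
  have symB: "transpose B = B" and psdB: "\<And>x. 0 \<le> x \<bullet> (B *v x)"
    using B by (auto simp: pos_semidef_def)
  have symM: "transpose M = M"
    using \<open>pos_semidef M\<close> by (simp add: pos_semidef_def)
  define e :: "real^'n" where "e = axis i 1"
  define s where "s = (\<Sum>j\<in>UNIV. (M $ i $ j)\<^sup>2)"
  have entry: "e \<bullet> (C *v e) = C $ i $ i" for C :: "real^'n^'n"
    by (simp add: e_def matrix_vector_mult_basis column_def inner_axis')
  have BBe: "B *v (B *v e) = M *v e"
    by (simp add: matrix_vector_mul_assoc BB)
  have m2: "(B *v e) \<bullet> (B *v e) = M $ i $ i"
    by (metis BBe entry symmetric_matrix_self_adjoint[OF symB])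
  have "M $ j $ i = M $ i $ j" for j
    by (metis symM transpose_def vec_lambda_beta)
  then have m4: "(M *v e) \<bullet> (M *v e) = s"
    by (simp add: e_def matrix_vector_mult_basis column_def inner_vec_def s_def power2_eq_square)
  have b0: "0 \<le> B $ i $ i"
    using psdB[of e] by (simp add: entry)
  have M0: "0 \<le> M $ i $ i"
    unfolding m2[symmetric] by simp
  have s0: "0 \<le> s" by (simp add: s_def sum_nonneg)
  have "(M $ i $ i) ^ 3 \<le> (B $ i $ i)\<^sup>2 * s"
    using pos_semidef_moment_inequality[OF B, of e] by (simp add: BBe m2 m4 entry)
  then have "sqrt ((M $ i $ i) ^ 3) \<le> B $ i $ i * sqrt s"
    using b0 real_sqrt_le_mono by (fastforce simp: real_sqrt_mult)
  moreover have "(M $ i $ i) powr (3 / 2) = sqrt ((M $ i $ i) ^ 3)"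
    using M0 by (cases "M $ i $ i = 0") (simp_all add: powr_half_sqrt[symmetric] powr_powr
        flip: powr_numeral)
  moreover have "s powr (1 / 2) = sqrt s"
    using s0 by (rule powr_half_sqrt)
  ultimately have "(M $ i $ i) powr (3 / 2) / s powr (1 / 2) \<le> B $ i $ i"
    using b0 s0 by (cases "s = 0") (simp_all add: divide_le_eq)
  then show ?thesis by (simp add: B_def s_def)
qed

section \<open>The Randic matrix\<close>

text \<open>
  Each common neighbour \<open>k\<close> contributes \<open>1 / sqrt (d i * d k) * (1 / sqrt (d j * d k))\<close>, where the
  two factors \<open>sqrt (d k)\<close> combine to \<open>d k\<close>.
\<close>

lemma randic_matrix_mult_transpose_entry:
  fixes v :: "'n::finite \<Rightarrow> 'a"
  assumes "pair_graph G"
  defines "d \<equiv> degree_at G v" and "adj \<equiv> adjacent_at G v"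
  shows "(randic_matrix G v ** transpose (randic_matrix G v)) $ i $ j
    = 1 / sqrt (d i * d j) * (\<Sum>k | adj k i \<and> adj k j. 1 / d k)"
proof -
  interpret pair_graph G by fact
  have sym: "adj x y \<longleftrightarrow> adj y x" for x y
    unfolding adj_def adjacent_at_def by (auto intro: graph_symmetric)
  have d: "0 \<le> d k" for k by (simp add: d_def degree_at_def)
  have "(randic_matrix G v ** transpose (randic_matrix G v)) $ i $ j
    = (\<Sum>k\<in>UNIV. if adj k i \<and> adj k j then 1 / sqrt (d i * d j) * (1 / d k) else 0)"
    using d sym by (auto simp: matrix_matrix_mult_def transpose_def randic_matrix_def
        real_sqrt_mult simp flip: d_def adj_def intro!: sum.cong)
  also have "\<dots> = (\<Sum>k | adj k i \<and> adj k j. 1 / sqrt (d i * d j) * (1 / d k))"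
    by (simp add: sum.If_cases)
  finally show ?thesis by (simp only: sum_distrib_left)
qed

theorem theorem3p8:
  fixes G :: "'a pair_pre_digraph" and v :: "'n::finite \<Rightarrow> 'a" and i :: 'n
  assumes "pair_graph G"
    and "Digraph_Component.connected G"
    and "CARD('n) \<ge> 2"
    and "bij_betw v UNIV (pverts G)"
  defines "d \<equiv> degree_at G v"
    and "adj \<equiv> adjacent_at G v"
  shows "randic_vertex_energy G v i \<ge>
    (1 / d i * (\<Sum>j | adj j i. 1 / d j)) powr (3 / 2) /
    (\<Sum>j\<in>UNIV. 1 / (d i * d j) * (\<Sum>k | adj k i \<and> adj k j. 1 / d k)\<^sup>2) powr (1 / 2)"
proof -
  define M where "M = randic_matrix G v ** transpose (randic_matrix G v)"
  have entry: "M $ i $ j = 1 / sqrt (d i * d j) * (\<Sum>k | adj k i \<and> adj k j. 1 / d k)" for j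
    unfolding M_def d_def adj_def using assms(1) by (rule randic_matrix_mult_transpose_entry)
  have d: "0 \<le> d k" for k by (simp add: d_def degree_at_def)
  have "M $ i $ i = 1 / d i * (\<Sum>j | adj j i. 1 / d j)"
    using d[of i] by (simp add: entry)
  moreover have "(M $ i $ j)\<^sup>2
      = 1 / (d i * d j) * (\<Sum>k | adj k i \<and> adj k j. 1 / d k)\<^sup>2" for j
    using d by (simp add: entry power_mult_distrib power_divide)
  ultimately show ?thesis
    using mat_abs_diagonal_lower_bound[of "randic_matrix G v" i]
    by (simp add: randic_vertex_energy_def flip: M_def)
qed

end
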